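(* Let $\Gamma=(\omega^{\omega},E)$ be a graph whose vertex set is the Baire space $\omega^\omega$, and let $\mathfrak{p}:\omega^\omega\to\{p^n : p \text{ prime}, n\ge 1\}\cup\{\infty\}$. Suppose that $E$ is closed in the Baire space (i.e. closed as a subset of $\omega^\omega\times\omega^\omega$ with the product topology) and that $\mathfrak{p}(\eta)$ depends only on $\eta(0)$. Then $G=G(\Gamma,\mathfrak{p})$ admits a left-invariant separable group ultrametric extending the standard metric on the Baire space.
   Context: For a graph $\Gamma=(V,E)$ and a map $\mathfrak{p}:V\to\{p^n : p\text{ prime}, n\ge1\}\cup\{\infty\}$ (called a graph colouring; no properness is required), $G(\Gamma,\mathfrak{p})$ is the group with presentation $\langle V \mid a^{\mathfrak{p}(a)}=1 \text{ for } a\in V \text{ with } \mathfrak{p}(a)\neq\infty;\ bc=cb \text{ for } b,c\in V \text{ with } bEc\rangle$. Vertices of $\Gamma$ are thus elements (generators) of $G$. By convention the edge relation is taken to be reflexive (every vertex is adjacent to itself), which does not affect the group. A left-invariant group ultrametric on $G$ is an ultrametric $d$ on $G$ with $d(gh,gk)=d(h,k)$ for all $g,h,k\in G$; it is separable if $(G,d)$ is a separable metric space. "Extending the standard metric on the Baire space" means that the restriction of $d$ to the generators $\omega^\omega\subseteq G$ is the standard ultrametric of the Baire space, in which the distance of distinct $\eta,\nu$ is determined by the length of their longest common initial segment (concretely $2^{-(n+1)}$ where $n$ is that length). *)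

theory Defs
  imports
    "HOL-Analysis.Analysis"
    "HOL-Algebra.Generated_Groups"
    "HOL-Number_Theory.Prime_Powers"
    "HOL-Library.Extended_Nat"
begin

section \<open>Groups given by generators and relations\<close>

text \<open>The letter \<open>(v, True)\<close> stands for the generator \<open>v\<close> and \<open>(v, False)\<close> for its formal
  inverse. A pair \<open>(u, w)\<close> in a set of relations stands for the relation \<open>u = w\<close>.\<close>

type_synonym 'v gword = "('v \<times> bool) list"

inductive pres_eq :: "('v gword \<times> 'v gword) set \<Rightarrow> 'v gword \<Rightarrow> 'v gword \<Rightarrow> bool"
  for R :: "('v gword \<times> 'v gword) set"
where
  pres_refl: "pres_eq R u u"
| pres_sym: "pres_eq R u w \<Longrightarrow> pres_eq R w u"
| pres_trans: "pres_eq R u v \<Longrightarrow> pres_eq R v w \<Longrightarrow> pres_eq R u w"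
| pres_append: "pres_eq R u u' \<Longrightarrow> pres_eq R w w' \<Longrightarrow> pres_eq R (u @ w) (u' @ w')"
| pres_cancel: "pres_eq R [(v, e), (v, \<not> e)] []"
| pres_relation: "(u, w) \<in> R \<Longrightarrow> pres_eq R u w"

definition pres_cong :: "('v gword \<times> 'v gword) set \<Rightarrow> ('v gword \<times> 'v gword) set" where
  "pres_cong R = {(u, w). pres_eq R u w}"

definition pres_class :: "('v gword \<times> 'v gword) set \<Rightarrow> 'v gword \<Rightarrow> 'v gword set" where
  "pres_class R u = pres_cong R `` {u}"

definition presented_group :: "('v gword \<times> 'v gword) set \<Rightarrow> 'v gword set monoid" where
  "presented_group R =
     \<lparr>carrier = UNIV // pres_cong R,
      mult = (\<lambda>A B. \<Union>u\<in>A. \<Union>w\<in>B. pres_class R (u @ w)),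
      one = pres_class R []\<rparr>"

lemma equiv_pres_cong: "equiv UNIV (pres_cong R)"
  by (rule equivI) (auto simp: pres_cong_def refl_on_def sym_def trans_def
      intro: pres_refl pres_sym pres_trans)

lemma pres_class_eq_iff: "pres_class R u = pres_class R w \<longleftrightarrow> pres_eq R u w"
  unfolding pres_class_def using eq_equiv_class_iff[OF equiv_pres_cong, of u w R]
  by (simp add: pres_cong_def)

lemma carrier_presented_group: "carrier (presented_group R) = range (pres_class R)"
  by (auto simp: presented_group_def quotient_def pres_class_def)

lemma one_presented_group: "\<one>\<^bsub>presented_group R\<^esub> = pres_class R []"
  by (simp add: presented_group_def)

lemma mem_pres_class: "w \<in> pres_class R u \<longleftrightarrow> pres_eq R u w"
  by (simp add: pres_class_def pres_cong_def)

lemma mult_presented_group: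
  "pres_class R u \<otimes>\<^bsub>presented_group R\<^esub> pres_class R w = pres_class R (u @ w)"
proof -
  have "pres_class R (u' @ w') = pres_class R (u @ w)"
    if "u' \<in> pres_class R u" "w' \<in> pres_class R w" for u' w'
  proof -
    have "pres_eq R (u @ w) (u' @ w')"
      using that unfolding mem_pres_class by (rule pres_append)
    thus ?thesis unfolding pres_class_eq_iff by (rule pres_sym)
  qed
  hence "(\<Union>u'\<in>pres_class R u. \<Union>w'\<in>pres_class R w. pres_class R (u' @ w')) =
         (\<Union>u'\<in>pres_class R u. \<Union>w'\<in>pres_class R w. pres_class R (u @ w))"
    by (intro SUP_cong refl)
  also have "\<dots> = pres_class R (u @ w)"
  proof -
    have "u \<in> pres_class R u" "w \<in> pres_class R w"
      by (simp_all add: mem_pres_class pres_refl)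
    thus ?thesis by blast
  qed
  finally show ?thesis
    by (simp add: presented_group_def)
qed

definition inv_word :: "'v gword \<Rightarrow> 'v gword" where
  "inv_word u = rev (map (\<lambda>(v, e). (v, \<not> e)) u)"

lemma pres_eq_inv_word: "pres_eq R (inv_word u @ u) []"
proof (induction u)
  case Nil
  show ?case by (simp add: inv_word_def pres_refl)
next
  case (Cons l u)
  obtain v e where l: "l = (v, e)" by fastforce
  have "pres_eq R ([(v, \<not> e), (v, e)] @ u) ([] @ u)"
    using pres_cancel[of R v "\<not> e"] by (intro pres_append pres_refl) simp
  hence "pres_eq R (inv_word u @ [(v, \<not> e), (v, e)] @ u) (inv_word u @ u)"
    by (intro pres_append pres_refl) simp
  hence "pres_eq R (inv_word (l # u) @ l # u) (inv_word u @ u)"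
    by (simp add: inv_word_def l)
  thus ?case using Cons.IH by (rule pres_trans)
qed

lemma group_presented_group: "group (presented_group R)"
proof (rule groupI)
  fix x assume "x \<in> carrier (presented_group R)"
  then obtain u where "x = pres_class R u" by (auto simp: carrier_presented_group)
  thus "\<exists>y\<in>carrier (presented_group R). y \<otimes>\<^bsub>presented_group R\<^esub> x = \<one>\<^bsub>presented_group R\<^esub>"
    by (intro bexI[of _ "pres_class R (inv_word u)"])
      (auto simp: carrier_presented_group one_presented_group mult_presented_group
        pres_class_eq_iff pres_eq_inv_word)
qed (auto simp: carrier_presented_group one_presented_group mult_presented_group)

section \<open>Graph products of cyclic groups\<close>

definition graph_relations ::
    "('v \<times> 'v) set \<Rightarrow> ('v \<Rightarrow> enat) \<Rightarrow> ('v gword \<times> 'v gword) set" where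
  "graph_relations E p =
     {(replicate n (a, True), []) | a n. p a = enat n} \<union>
     {([(b, True), (c, True)], [(c, True), (b, True)]) | b c. (b, c) \<in> E}"

definition graph_group :: "('v \<times> 'v) set \<Rightarrow> ('v \<Rightarrow> enat) \<Rightarrow> 'v gword set monoid" where
  "graph_group E p = presented_group (graph_relations E p)"

definition graph_gen :: "('v \<times> 'v) set \<Rightarrow> ('v \<Rightarrow> enat) \<Rightarrow> 'v \<Rightarrow> 'v gword set" where
  "graph_gen E p v = pres_class (graph_relations E p) [(v, True)]"

definition graph_colouring :: "('v \<Rightarrow> enat) \<Rightarrow> bool" where
  "graph_colouring p \<longleftrightarrow> (\<forall>v. p v = \<infinity> \<or> (\<exists>q. primepow q \<and> p v = enat q))"

lemma group_graph_group: "group (graph_group E p)"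
  unfolding graph_group_def by (rule group_presented_group)

lemma graph_gen_closed: "graph_gen E p v \<in> carrier (graph_group E p)"
  by (simp add: graph_gen_def graph_group_def carrier_presented_group)

lemma graph_gen_pow:
  "graph_gen E p v [^]\<^bsub>graph_group E p\<^esub> n =
     pres_class (graph_relations E p) (replicate n (v, True))" for n :: nat
proof -
  interpret group "graph_group E p" by (rule group_graph_group)
  show ?thesis
    by (induction n)
      (simp_all add: graph_gen_def graph_group_def one_presented_group mult_presented_group
        flip: replicate_append_same)
qed

lemma graph_gen_pow_eq_one:
  assumes "p v = enat n"
  shows "graph_gen E p v [^]\<^bsub>graph_group E p\<^esub> n = \<one>\<^bsub>graph_group E p\<^esub>"
proof -
  have "pres_eq (graph_relations E p) (replicate n (v, True)) []"
    using assms by (intro pres_relation) (auto simp: graph_relations_def)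
  thus ?thesis
    unfolding graph_gen_pow by (simp add: graph_group_def one_presented_group pres_class_eq_iff)
qed

lemma graph_gen_commute:
  assumes "(b, c) \<in> E"
  shows "graph_gen E p b \<otimes>\<^bsub>graph_group E p\<^esub> graph_gen E p c =
         graph_gen E p c \<otimes>\<^bsub>graph_group E p\<^esub> graph_gen E p b"
proof -
  have "pres_eq (graph_relations E p) [(b, True), (c, True)] [(c, True), (b, True)]"
    using assms by (intro pres_relation) (auto simp: graph_relations_def)
  thus ?thesis
    by (simp add: graph_gen_def graph_group_def mult_presented_group pres_class_eq_iff)
qed

text \<open>The universal property of the presentation.\<close>

lemma graph_group_universal:
  fixes H (structure) and E :: "('v \<times> 'v) set"
  assumes "group H"
    and f: "\<And>v. f v \<in> carrier H"
    and pow: "\<And>v n. p v = enat n \<Longrightarrow> f v [^] n = \<one>"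
    and comm: "\<And>b c. (b, c) \<in> E \<Longrightarrow> f b \<otimes> f c = f c \<otimes> f b"
  shows "\<exists>h\<in>hom (graph_group E p) H. \<forall>v. h (graph_gen E p v) = f v"
proof -
  interpret H: group H by fact
  let ?R = "graph_relations E p"
  define ev :: "'v gword \<Rightarrow> _"
    where "ev u = foldr (\<lambda>(v, e) x. (if e then f v else inv f v) \<otimes> x) u \<one>" for u
  have ev_Nil: "ev [] = \<one>"
    and ev_Cons: "ev ((v, e) # u) = (if e then f v else inv f v) \<otimes> ev u" for v e u
    by (simp_all add: ev_def)
  have ev_closed: "ev u \<in> carrier H" for u
    by (induction u) (auto simp: ev_Nil ev_Cons f)
  have ev_append: "ev (u @ w) = ev u \<otimes> ev w" for u w
    by (induction u) (auto simp: ev_Nil ev_Cons f ev_closed H.m_assoc)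
  have ev_rep: "ev (replicate n (v, True)) = f v [^] n" for n v
    using H.nat_pow_Suc2[OF f] by (induction n) (simp_all add: ev_Nil ev_Cons)
  have ev_eq: "ev u = ev w" if "pres_eq ?R u w" for u w
    using that
  proof induction
    case (pres_relation u w)
    thus ?case
      by (auto simp: graph_relations_def ev_rep pow ev_Nil ev_Cons f intro: comm)
  qed (auto simp: ev_append ev_Nil ev_Cons f)
  define h where "h A = ev (SOME u. u \<in> A)" for A
  have h: "h (pres_class ?R u) = ev u" for u
  proof -
    have "u \<in> pres_class ?R u" by (simp add: mem_pres_class pres_refl)
    hence "(SOME w. w \<in> pres_class ?R u) \<in> pres_class ?R u" by (rule someI)
    hence "pres_eq ?R u (SOME w. w \<in> pres_class ?R u)" by (simp only: mem_pres_class)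
    from ev_eq[OF this] show ?thesis unfolding h_def by (rule sym)
  qed
  have "h \<in> hom (graph_group E p) H"
    by (rule homI)
      (auto simp: graph_group_def carrier_presented_group mult_presented_group h
        ev_closed ev_append)
  moreover have "h (graph_gen E p v) = f v" for v
    by (simp add: graph_gen_def h ev_Cons ev_Nil f)
  ultimately show ?thesis by blast
qed

section \<open>Metrics\<close>

definition ultrametric_on :: "'a set \<Rightarrow> ('a \<Rightarrow> 'a \<Rightarrow> real) \<Rightarrow> bool" where
  "ultrametric_on M d \<longleftrightarrow>
     Metric_space M d \<and> (\<forall>x\<in>M. \<forall>y\<in>M. \<forall>z\<in>M. d x z \<le> max (d x y) (d y z))"

definition left_invariant_ultrametric ::
    "('a, 'b) monoid_scheme \<Rightarrow> ('a \<Rightarrow> 'a \<Rightarrow> real) \<Rightarrow> bool" where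
  "left_invariant_ultrametric G d \<longleftrightarrow>
     ultrametric_on (carrier G) d \<and>
     (\<forall>g\<in>carrier G. \<forall>h\<in>carrier G. \<forall>k\<in>carrier G. d (g \<otimes>\<^bsub>G\<^esub> h) (g \<otimes>\<^bsub>G\<^esub> k) = d h k)"

text \<open>For equal arguments the length below is unspecified; \<open>baire_dist\<close> treats that case
  separately.\<close>

definition common_prefix_length :: "(nat \<Rightarrow> nat) \<Rightarrow> (nat \<Rightarrow> nat) \<Rightarrow> nat" where
  "common_prefix_length \<eta> \<nu> = (GREATEST n. \<forall>i<n. \<eta> i = \<nu> i)"

definition baire_dist :: "(nat \<Rightarrow> nat) \<Rightarrow> (nat \<Rightarrow> nat) \<Rightarrow> real" where
  "baire_dist \<eta> \<nu> = (if \<eta> = \<nu> then 0 else (1 / 2) ^ (common_prefix_length \<eta> \<nu> + 1))"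

end

theory Submission
  imports Defs "HOL-Number_Theory.Cong"
begin

text \<open>Let \<open>G\<^sub>n\<close> be the quotient of \<open>G\<close> obtained by identifying generators that agree below \<open>n\<close>,
  and let \<open>d(g, h) = (1/2)^(n+1)\<close> where \<open>n\<close> is least such that \<open>g\<close> and \<open>h\<close> differ in \<open>G\<^bsub>n+1\<^esub>\<close>.
  This is a left-invariant ultrametric as soon as elements that agree in all \<open>G\<^sub>n\<close> are equal.
  To see the latter, take two words and let \<open>F\<close> be the finite set of generators in them.
  As \<open>E\<close> is closed, for large \<open>n\<close> the cones of depth \<open>n\<close> around the elements of \<open>F\<close> are disjoint
  and \<open>E\<close> joins the cones of \<open>f\<close> and \<open>g\<close> only if it joins \<open>f\<close> and \<open>g\<close>. Hence sending
  every generator in the cone of \<open>f \<in> F\<close> to \<open>f\<close>, and all other generators to \<open>1\<close>, defines a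
  homomorphism \<open>G\<^sub>n \<rightarrow> G\<close> which fixes \<open>F\<close>, so equality of the words in \<open>G\<^sub>n\<close> implies
  equality in \<open>G\<close>. Exponent sums over a cone, modulo \<open>p\<close>, separate generators in \<open>G\<^sub>n\<close>, and the
  words in eventually vanishing sequences are dense.\<close>

section \<open>Ultrametrics from sequences of equivalence relations\<close>

text \<open>The shift in the exponent matches \<open>baire_dist\<close>. The relations
  \<open>Q n\<close> need not be nested; only the first failing level counts.\<close>

definition level_dist :: "(nat \<Rightarrow> 'a \<Rightarrow> 'a \<Rightarrow> bool) \<Rightarrow> 'a \<Rightarrow> 'a \<Rightarrow> real" where
  "level_dist Q x y =
     (if \<forall>n. Q n x y then 0 else (1 / 2) ^ ((LEAST n. \<not> Q n x y) + 1))"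

lemma level_dist_nonneg: "0 \<le> level_dist Q x y"
  by (simp add: level_dist_def)

lemma level_dist_eq_0_iff: "level_dist Q x y = 0 \<longleftrightarrow> (\<forall>n. Q n x y)"
  by (simp add: level_dist_def)

text \<open>A nonzero distance is \<open>(1/2)^(l+1)\<close> with \<open>l\<close> the first failing
  level, so the bound amounts to \<open>n \<le> l\<close>. This reduces the ultrametric inequality
  to transitivity of each \<open>Q k\<close>.\<close>

lemma level_dist_le_iff: "level_dist Q x y \<le> (1 / 2) ^ (n + 1) \<longleftrightarrow> (\<forall>k<n. Q k x y)"
proof (cases "\<forall>n. Q n x y")
  case True
  then show ?thesis by (simp add: level_dist_def)
next
  case False
  define l where "l = (LEAST n. \<not> Q n x y)"
  have l: "\<not> Q l x y" "\<And>k. k < l \<Longrightarrow> Q k x y"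
    unfolding l_def using LeastI_ex[of "\<lambda>n. \<not> Q n x y"] False
    by (auto dest: not_less_Least)
  have "level_dist Q x y = (1 / 2) ^ (l + 1)"
    using False unfolding level_dist_def l_def by (simp del: power_Suc)
  then have "level_dist Q x y \<le> (1 / 2) ^ (n + 1) \<longleftrightarrow> n \<le> l"
    by (simp add: power_decreasing_iff)
  then show ?thesis
    using l by (meson le_less_linear less_le_trans)
qed

lemma level_dist_commute:
  assumes "\<And>n. equivp (Q n)"
  shows "level_dist Q x y = level_dist Q y x"
proof -
  have "Q n x y = Q n y x" for n
    using assms equivp_symp by metis
  then show ?thesis by (simp add: level_dist_def)
qed

lemma level_dist_ultra:
  assumes "\<And>n. equivp (Q n)"
  shows "level_dist Q x z \<le> max (level_dist Q x y) (level_dist Q y z)"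
    (is "_ \<le> ?m")
proof -
  have "level_dist Q a b = 0 \<or> (\<exists>n. level_dist Q a b = (1 / 2) ^ (n + 1))" for a b
    unfolding level_dist_def by metis
  then consider "?m = 0" | n where "?m = (1 / 2) ^ (n + 1)"
    unfolding max_def by metis
  then show ?thesis
  proof cases
    case 1
    then have "level_dist Q x y = 0" "level_dist Q y z = 0"
      using level_dist_nonneg[of Q x y] level_dist_nonneg[of Q y z] by linarith+
    then have "level_dist Q x z = 0"
      unfolding level_dist_eq_0_iff using assms equivp_transp by metis
    then show ?thesis using 1 by simp
  next
    case 2
    then have "level_dist Q x y \<le> (1 / 2) ^ (n + 1)" "level_dist Q y z \<le> (1 / 2) ^ (n + 1)"
      by linarith+
    then have "level_dist Q x z \<le> (1 / 2) ^ (n + 1)"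
      unfolding level_dist_le_iff using assms equivp_transp by metis
    then show ?thesis using 2 by simp
  qed
qed

lemma level_dist_cong:
  assumes "\<And>n. equivp (Q n)" and "\<And>n. Q n x x'" and "\<And>n. Q n y y'"
  shows "level_dist Q x y = level_dist Q x' y'"
proof -
  have "Q n x y = Q n x' y'" for n
    using assms equivp_symp equivp_transp by metis
  then show ?thesis by (simp add: level_dist_def)
qed

section \<open>Presented groups\<close>

lemma equivp_pres_eq: "equivp (pres_eq R)"
  by (rule equivpI) (auto simp: reflp_def symp_def transp_def
      intro: pres_refl pres_sym pres_trans)

text \<open>Multiplying by \<open>inv_word u\<close> on the left removes the prefix. Applied at
  every level, this yields left invariance of the metric.\<close>

lemma pres_eq_append_cancel: "pres_eq R (u @ v) (u @ w) \<longleftrightarrow> pres_eq R v w"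
proof
  assume *: "pres_eq R (u @ v) (u @ w)"
  have cancel: "pres_eq R (inv_word u @ u @ x) x" for x
    using pres_append[OF pres_eq_inv_word[of R u] pres_refl[of R x]] by simp
  have "pres_eq R (inv_word u @ u @ v) (inv_word u @ u @ w)"
    using pres_refl * by (rule pres_append)
  with pres_sym[OF cancel[of v]] have "pres_eq R v (inv_word u @ u @ w)"
    by (rule pres_trans)
  then show "pres_eq R v w"
    using cancel[of w] by (rule pres_trans)
qed (intro pres_append pres_refl)

lemma pres_eq_mono:
  assumes "pres_eq R u w" and "R \<subseteq> R'"
  shows "pres_eq R' u w"
  using assms(1)
  by induction (use assms(2) in \<open>auto intro: pres_eq.intros\<close>)

text \<open>Partiality of \<open>\<sigma>\<close> lets a generator be sent to the identity, as
  needed for a retraction onto finitely many generators.\<close>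

definition subst_word :: "('v \<Rightarrow> 'w option) \<Rightarrow> 'v gword \<Rightarrow> 'w gword" where
  "subst_word \<sigma> u =
     concat (map (\<lambda>(v, e). case \<sigma> v of None \<Rightarrow> [] | Some w \<Rightarrow> [(w, e)]) u)"

lemma subst_word_simps [simp]:
  "subst_word \<sigma> [] = []"
  "subst_word \<sigma> ((v, e) # u) =
     (case \<sigma> v of None \<Rightarrow> subst_word \<sigma> u | Some w \<Rightarrow> (w, e) # subst_word \<sigma> u)"
  "subst_word \<sigma> (u @ u') = subst_word \<sigma> u @ subst_word \<sigma> u'"
  by (auto simp: subst_word_def split: option.splits)

lemma subst_word_replicate:
  "subst_word \<sigma> (replicate n (v, e)) =
     (case \<sigma> v of None \<Rightarrow> [] | Some w \<Rightarrow> replicate n (w, e))"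
  by (induction n) (auto split: option.splits)

lemma subst_word_ident:
  assumes "\<And>v. v \<in> fst ` set u \<Longrightarrow> \<sigma> v = Some v"
  shows "subst_word \<sigma> u = u"
  using assms by (induction u) auto

text \<open>A cancelling pair goes to a cancelling pair or to the empty word, so only the defining
  relations have to be checked for the substitution to induce a homomorphism.\<close>

lemma pres_eq_subst_word:
  assumes "pres_eq R u w"
    and rel: "\<And>u w. (u, w) \<in> R \<Longrightarrow> pres_eq R' (subst_word \<sigma> u) (subst_word \<sigma> w)"
  shows "pres_eq R' (subst_word \<sigma> u) (subst_word \<sigma> w)"
  using assms(1)
proof induction
  case (pres_cancel v e)
  then show ?case
    by (auto split: option.splits intro: pres_eq.intros)
qed (auto intro: rel pres_eq.intros)

definition exponent_sum :: "('v \<Rightarrow> int) \<Rightarrow> 'v gword \<Rightarrow> int" where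
  "exponent_sum h u = (\<Sum>(v, e)\<leftarrow>u. if e then h v else - h v)"

lemma exponent_sum_simps [simp]:
  "exponent_sum h [] = 0"
  "exponent_sum h ((v, e) # u) = (if e then h v else - h v) + exponent_sum h u"
  "exponent_sum h (u @ w) = exponent_sum h u + exponent_sum h w"
  by (simp_all add: exponent_sum_def)

lemma exponent_sum_replicate: "exponent_sum h (replicate n (v, True)) = int n * h v"
  by (induction n) (auto simp: algebra_simps)

lemma exponent_sum_cong:
  assumes "pres_eq R u w"
    and rel: "\<And>u w. (u, w) \<in> R \<Longrightarrow> [exponent_sum h u = exponent_sum h w] (mod m)"
  shows "[exponent_sum h u = exponent_sum h w] (mod m)"
  using assms(1)
proof induction
  case (pres_sym u w)
  then show ?case by (simp add: cong_sym)
next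
  case (pres_trans u v w)
  then show ?case by (blast intro: cong_trans)
qed (auto intro: rel cong_add)

section \<open>Finite approximations of a graph on the Baire space\<close>

definition agree :: "nat \<Rightarrow> (nat \<Rightarrow> 'a) \<Rightarrow> (nat \<Rightarrow> 'a) \<Rightarrow> bool" where
  "agree n \<eta> \<nu> \<longleftrightarrow> (\<forall>i<n. \<eta> i = \<nu> i)"

lemma agree_refl [simp]: "agree n \<eta> \<eta>"
  by (simp add: agree_def)

lemma agree_sym: "agree n \<eta> \<nu> \<Longrightarrow> agree n \<nu> \<eta>"
  by (simp add: agree_def)

lemma agree_trans: "agree n \<eta> \<nu> \<Longrightarrow> agree n \<nu> \<xi> \<Longrightarrow> agree n \<eta> \<xi>"
  by (simp add: agree_def)

lemma agree_mono: "agree n \<eta> \<nu> \<Longrightarrow> k \<le> n \<Longrightarrow> agree k \<eta> \<nu>"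
  by (auto simp: agree_def)

lemma eventually_agree_imp_eq: "\<forall>\<^sub>F n in sequentially. agree n \<eta> \<nu> \<longrightarrow> \<eta> = \<nu>"
proof (cases "\<eta> = \<nu>")
  case False
  then obtain i where "\<eta> i \<noteq> \<nu> i" by blast
  then show ?thesis
    unfolding eventually_sequentially agree_def by (intro exI[of _ "Suc i"]) auto
qed simp

lemma tendsto_of_agree:
  fixes f :: "nat \<Rightarrow> nat \<Rightarrow> 'a::topological_space"
  assumes "\<And>n. agree n \<eta> (f n)"
  shows "f \<longlonglongrightarrow> \<eta>"
proof -
  have "(\<lambda>n. f n i) \<longlonglongrightarrow> \<eta> i" for i
  proof (rule tendsto_eventually)
    show "\<forall>\<^sub>F n in sequentially. f n i = \<eta> i"
      unfolding eventually_sequentially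
      using assms unfolding agree_def by (metis Suc_le_eq)
  qed
  then have "limitin (product_topology (\<lambda>i. euclidean) UNIV) f \<eta> sequentially"
    by (simp add: limitin_componentwise)
  then show ?thesis
    by (simp add: euclidean_product_topology)
qed

text \<open>Edges between the two cones at every depth would converge to \<open>(f, g)\<close>,
  which closedness then puts in \<open>E\<close>. A depth without such edges stays so further down,
  since the cones shrink.\<close>

lemma eventually_edge_of_agree:
  fixes E :: "((nat \<Rightarrow> nat) \<times> (nat \<Rightarrow> nat)) set"
  assumes "closed E"
  shows "\<forall>\<^sub>F n in sequentially.
           (\<exists>\<eta> \<nu>. (\<eta>, \<nu>) \<in> E \<and> agree n f \<eta> \<and> agree n g \<nu>) \<longrightarrow> (f, g) \<in> E"
proof (cases "(f, g) \<in> E")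
  case False
  have "\<exists>n. \<not> (\<exists>\<eta> \<nu>. (\<eta>, \<nu>) \<in> E \<and> agree n f \<eta> \<and> agree n g \<nu>)"
  proof (rule ccontr)
    assume "\<not> ?thesis"
    then obtain x y where xy: "\<And>n. (x n, y n) \<in> E" "\<And>n. agree n f (x n)" "\<And>n. agree n g (y n)"
      by metis
    have "(\<lambda>n. (x n, y n)) \<longlonglongrightarrow> (f, g)"
      by (intro tendsto_Pair tendsto_of_agree xy)
    then have "(f, g) \<in> E"
      using closed_sequentially[OF assms, of "\<lambda>n. (x n, y n)"] xy(1) by blast
    with False show False ..
  qed
  then obtain N where "\<not> (\<exists>\<eta> \<nu>. (\<eta>, \<nu>) \<in> E \<and> agree N f \<eta> \<and> agree N g \<nu>)" ..
  then show ?thesis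
    unfolding eventually_sequentially by (meson agree_mono)
qed simp

definition level_relations ::
    "((nat \<Rightarrow> nat) \<times> (nat \<Rightarrow> nat)) set \<Rightarrow> ((nat \<Rightarrow> nat) \<Rightarrow> enat) \<Rightarrow> nat \<Rightarrow>
     ((nat \<Rightarrow> nat) gword \<times> (nat \<Rightarrow> nat) gword) set" where
  "level_relations E p n =
     graph_relations E p \<union> {([(\<eta>, True)], [(\<nu>, True)]) | \<eta> \<nu>. agree n \<eta> \<nu>}"

lemma pres_eq_level_of_graph:
  "pres_eq (graph_relations E p) u w \<Longrightarrow> pres_eq (level_relations E p n) u w"
  by (erule pres_eq_mono) (auto simp: level_relations_def)

lemma pres_eq_level_gen:
  assumes "agree n \<eta> \<nu>"
  shows "pres_eq (level_relations E p n) [(\<eta>, e)] [(\<nu>, e)]"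
proof (cases e)
  case True
  then show ?thesis
    using assms by (intro pres_relation) (auto simp: level_relations_def)
next
  case False
  let ?R = "level_relations E p n"
  \<comment> \<open>The added relations concern positive letters only. For inverses,
    \<open>\<nu> \<eta>^-1\<close> and \<open>\<nu> \<nu>^-1\<close> both reduce to the identity,
    and \<open>\<nu>\<close> cancels.\<close>
  have pos: "pres_eq ?R [(\<nu>, True)] [(\<eta>, True)]"
    using agree_sym[OF assms] by (intro pres_relation) (auto simp: level_relations_def)
  have "pres_eq ?R ([(\<nu>, True)] @ [(\<eta>, False)]) ([(\<eta>, True)] @ [(\<eta>, False)])"
    by (intro pres_append pos pres_refl)
  moreover have "pres_eq ?R [(\<eta>, True), (\<eta>, False)] []"
    using pres_cancel[of ?R \<eta> True] by simp
  moreover have "pres_eq ?R [] [(\<nu>, True), (\<nu>, False)]"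
    using pres_cancel[of ?R \<nu> True] by (simp add: pres_sym)
  ultimately have "pres_eq ?R ([(\<nu>, True)] @ [(\<eta>, False)]) ([(\<nu>, True)] @ [(\<nu>, False)])"
    by (auto intro: pres_trans)
  then have "pres_eq ?R [(\<eta>, False)] [(\<nu>, False)]"
    by (simp only: pres_eq_append_cancel)
  then show ?thesis using False by simp
qed

lemma pres_eq_level_map:
  assumes "\<And>v. agree n v (f v)"
  shows "pres_eq (level_relations E p n) u (map (apfst f) u)"
proof (induction u)
  case (Cons l u)
  obtain v e where l: "l = (v, e)" by fastforce
  have "pres_eq (level_relations E p n) ([(v, e)] @ u) ([(f v, e)] @ map (apfst f) u)"
    by (intro pres_append pres_eq_level_gen assms Cons.IH)
  then show ?case by (simp add: l)
qed (simp add: pres_refl)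

lemma pres_eq_level_gen_iff:
  assumes colouring: "graph_colouring p"
    and p: "\<And>\<eta> \<nu>. \<eta> 0 = \<nu> 0 \<Longrightarrow> p \<eta> = p \<nu>"
    and "n > 0"
  shows "pres_eq (level_relations E p n) [(\<eta>, True)] [(\<nu>, True)] \<longleftrightarrow> agree n \<eta> \<nu>"
proof
  assume eq: "pres_eq (level_relations E p n) [(\<eta>, True)] [(\<nu>, True)]"
  define h :: "(nat \<Rightarrow> nat) \<Rightarrow> int" where "h v = of_bool (agree n \<eta> v)" for v
  \<comment> \<open>The colour \<open>\<infinity>\<close> gives modulus 0, for which congruence is
    equality. Prime powers exceed 1, so 1 and 0 stay incongruent modulo \<open>m\<close> in either
    case.\<close>
  define m :: int where "m = (case p \<eta> of enat k \<Rightarrow> int k | \<infinity> \<Rightarrow> 0)"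
  have m: "\<not> m dvd 1"
    using colouring[unfolded graph_colouring_def, rule_format, of \<eta>] primepow_gt_Suc_0
    by (auto simp: m_def)
  \<comment> \<open>As \<open>n > 0\<close>, coordinate 0 is constant on the cone. The power
    relation of a generator in the cone thus changes the sum by a multiple of
    \<open>m\<close>.\<close>
  have p_agree: "p v = p \<eta>" if "agree n \<eta> v" for v
    using that \<open>n > 0\<close> by (intro p) (auto simp: agree_def)
  have "[exponent_sum h [(\<eta>, True)] = exponent_sum h [(\<nu>, True)]] (mod m)"
  proof (rule exponent_sum_cong[OF eq])
    fix u w assume "(u, w) \<in> level_relations E p n"
    then consider a k where "u = replicate k (a, True)" "w = []" "p a = enat k"
      | b c where "u = [(b, True), (c, True)]" "w = [(c, True), (b, True)]"
      | b c where "u = [(b, True)]" "w = [(c, True)]" "agree n b c"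
      unfolding level_relations_def graph_relations_def by blast
    then show "[exponent_sum h u = exponent_sum h w] (mod m)"
    proof cases
      case 1
      have "m dvd int k" if "agree n \<eta> a"
        unfolding m_def p_agree[OF that, symmetric] 1(3) by simp
      then show ?thesis
        using 1 by (simp add: exponent_sum_replicate h_def cong_0_iff)
    next
      case 2
      then show ?thesis by (simp add: add.commute)
    next
      case 3
      then have "h b = h c"
        by (auto simp: h_def intro: agree_trans agree_sym)
      then show ?thesis using 3 by simp
    qed
  qed
  then have "[1 = of_bool (agree n \<eta> \<nu>)] (mod m)"
    by (simp add: h_def)
  then show "agree n \<eta> \<nu>"
    using m by (cases "agree n \<eta> \<nu>") (simp_all add: cong_0_iff del: zdvd1_eq)
qed (rule pres_eq_level_gen)

lemma graph_relations_separated: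
  fixes E :: "((nat \<Rightarrow> nat) \<times> (nat \<Rightarrow> nat)) set"
  assumes "closed E"
    and p: "\<And>\<eta> \<nu>. \<eta> 0 = \<nu> 0 \<Longrightarrow> p \<eta> = p \<nu>"
    and eq: "\<And>n. pres_eq (level_relations E p (Suc n)) u w"
  shows "pres_eq (graph_relations E p) u w"
proof -
  let ?R = "graph_relations E p"
  define F where "F = fst ` set (u @ w)"
  have "finite F" by (simp add: F_def)
  define sep where "sep n f g \<longleftrightarrow> (agree n f g \<longrightarrow> f = g) \<and>
      ((\<exists>\<eta> \<nu>. (\<eta>, \<nu>) \<in> E \<and> agree n f \<eta> \<and> agree n g \<nu>) \<longrightarrow> (f, g) \<in> E)" for n f g
  have "\<forall>\<^sub>F n in sequentially. sep n f g" for f g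
    unfolding sep_def
    by (rule eventually_conj[OF eventually_agree_imp_eq eventually_edge_of_agree[OF \<open>closed E\<close>]])
  then have "\<forall>\<^sub>F n in sequentially. \<forall>f\<in>F. \<forall>g\<in>F. sep n f g"
    using \<open>finite F\<close> by (simp add: eventually_ball_finite)
  \<comment> \<open>One depth serves all pairs because \<open>F\<close> is finite. Depth at least 1
    makes \<open>p\<close> constant on each cone.\<close>
  then have "\<forall>\<^sub>F n in sequentially. n \<ge> 1 \<and> (\<forall>f\<in>F. \<forall>g\<in>F. sep n f g)"
    by (intro eventually_conj eventually_ge_at_top)
  then obtain n where "n \<ge> 1" and sep: "\<And>f g. f \<in> F \<Longrightarrow> g \<in> F \<Longrightarrow> sep n f g"
    using eventually_happens'[OF sequentially_bot] by blast
  have inj: "f = g" if "f \<in> F" "g \<in> F" "agree n f g" for f g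
    using sep[OF that(1,2)] that(3) by (simp add: sep_def)
  have edge: "(f, g) \<in> E"
    if "f \<in> F" "g \<in> F" "(\<eta>, \<nu>) \<in> E" "agree n f \<eta>" "agree n g \<nu>" for f g \<eta> \<nu>
    using sep[OF that(1,2)] that(3-5) unfolding sep_def by blast
  define \<sigma> where
    "\<sigma> v = (if \<exists>f\<in>F. agree n f v then Some (SOME f. f \<in> F \<and> agree n f v) else None)" for v
  have \<sigma>_Some: "f \<in> F \<and> agree n f v" if "\<sigma> v = Some f" for v f
  proof -
    have ex: "\<exists>f. f \<in> F \<and> agree n f v" and f: "f = (SOME f. f \<in> F \<and> agree n f v)"
      using that by (auto simp: \<sigma>_def split: if_splits)
    show ?thesis using someI_ex[OF ex] unfolding f .
  qed
  \<comment> \<open>The choice made by \<open>\<sigma>\<close> depends on \<open>v\<close> only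
    through the set of \<open>f \<in> F\<close> whose cones contain \<open>v\<close>.\<close>
  have \<sigma>_cong: "\<sigma> v = \<sigma> v'" if "agree n v v'" for v v'
  proof -
    have "agree n f v \<longleftrightarrow> agree n f v'" for f
      using that agree_sym agree_trans by metis
    then show ?thesis by (simp add: \<sigma>_def)
  qed
  have \<sigma>_ident: "\<sigma> f = Some f" if "f \<in> F" for f
  proof -
    have "\<exists>g\<in>F. agree n g f" using that agree_refl by blast
    then obtain g where "\<sigma> f = Some g" by (auto simp: \<sigma>_def)
    then show ?thesis using \<sigma>_Some inj that by metis
  qed
  have "pres_eq ?R (subst_word \<sigma> u) (subst_word \<sigma> w)"
  proof (rule pres_eq_subst_word)
    show "pres_eq (level_relations E p n) u w"
      using eq[of "n - 1"] \<open>n \<ge> 1\<close> by simp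
  next
    fix x y assume "(x, y) \<in> level_relations E p n"
    then consider a k where "x = replicate k (a, True)" "y = []" "p a = enat k"
      | b c where "x = [(b, True), (c, True)]" "y = [(c, True), (b, True)]" "(b, c) \<in> E"
      | b c where "x = [(b, True)]" "y = [(c, True)]" "agree n b c"
      unfolding level_relations_def graph_relations_def by blast
    then show "pres_eq ?R (subst_word \<sigma> x) (subst_word \<sigma> y)"
    proof cases
      case 1
      show ?thesis
      proof (cases "\<sigma> a")
        case None
        then show ?thesis using 1 by (simp add: subst_word_replicate pres_refl)
      next
        case (Some f)
        then have "p f = p a"
          using \<sigma>_Some[OF Some] \<open>n \<ge> 1\<close> by (intro p) (auto simp: agree_def)
        then have "(replicate k (f, True), []) \<in> ?R"
          using 1 by (auto simp: graph_relations_def)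
        then show ?thesis
          using 1 Some by (simp add: subst_word_replicate pres_relation)
      qed
    next
      case 2
      \<comment> \<open>This covers the case where both letters survive. If \<open>b\<close> or
        \<open>c\<close> is erased, the two images are the same word.\<close>
      have "([(f, True), (g, True)], [(g, True), (f, True)]) \<in> ?R"
        if "\<sigma> b = Some f" "\<sigma> c = Some g" for f g
        using edge[OF _ _ 2(3)] that[THEN \<sigma>_Some] by (auto simp: graph_relations_def)
      then show ?thesis
        using 2 by (auto split: option.splits intro: pres_refl pres_relation)
    next
      case 3
      then show ?thesis using \<sigma>_cong by (simp add: pres_refl)
    qed
  qed
  moreover have "subst_word \<sigma> u = u" "subst_word \<sigma> w = w"
    by (intro subst_word_ident \<sigma>_ident; auto simp: F_def)+
  ultimately show ?thesis by simp
qed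

section \<open>The ultrametric on the graph group\<close>

text \<open>Level \<open>n\<close> compares the first \<open>n + 1\<close> coordinates, so the first
  failing level is the first coordinate of disagreement, which is the length of the common
  prefix.\<close>

lemma baire_dist_eq_level_dist:
  "baire_dist \<eta> \<nu> = level_dist (\<lambda>n. agree (Suc n)) \<eta> \<nu>"
proof (cases "\<eta> = \<nu>")
  case False
  then obtain i where "\<eta> i \<noteq> \<nu> i" by blast
  define l where "l = (LEAST i. \<eta> i \<noteq> \<nu> i)"
  have l: "\<eta> l \<noteq> \<nu> l" "\<And>k. k < l \<Longrightarrow> \<eta> k = \<nu> k"
    unfolding l_def using LeastI[of "\<lambda>i. \<eta> i \<noteq> \<nu> i", OF \<open>\<eta> i \<noteq> \<nu> i\<close>]
    by (auto dest: not_less_Least)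
  have "(GREATEST n. \<forall>i<n. \<eta> i = \<nu> i) = l"
    using l by (intro Greatest_equality) (auto simp: not_less[symmetric])
  moreover have "(LEAST n. \<not> agree (Suc n) \<eta> \<nu>) = l"
    by (rule Least_equality)
      (use l in \<open>auto simp: agree_def not_less_eq intro: leI\<close>)
  moreover have "\<not> (\<forall>n. agree (Suc n) \<eta> \<nu>)"
    using l(1) by (auto simp: agree_def)
  ultimately show ?thesis
    using False by (simp add: baire_dist_def common_prefix_length_def level_dist_def)
qed (simp add: baire_dist_def level_dist_def)

theorem theorem2:
  fixes E :: "((nat \<Rightarrow> nat) \<times> (nat \<Rightarrow> nat)) set"
    and p :: "(nat \<Rightarrow> nat) \<Rightarrow> enat"
  assumes "refl E" and "sym E"
    and "closed E"
    and "graph_colouring p"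
    and "\<And>\<eta> \<nu>. \<eta> 0 = \<nu> 0 \<Longrightarrow> p \<eta> = p \<nu>"
  shows "\<exists>d. left_invariant_ultrametric (graph_group E p) d
           \<and> separable_space (Metric_space.mtopology (carrier (graph_group E p)) d)
           \<and> (\<forall>\<eta> \<nu>. d (graph_gen E p \<eta>) (graph_gen E p \<nu>) = baire_dist \<eta> \<nu>)"
proof -
  let ?R = "graph_relations E p" and ?G = "graph_group E p"
  \<comment> \<open>Starting at depth 1 aligns the levels with \<open>baire_dist\<close> and skips
    depth 0, where all generators are identified.\<close>
  define Q where "Q n = pres_eq (level_relations E p (Suc n))" for n
  have Q_equiv: "equivp (Q n)" for n
    by (simp add: Q_def equivp_pres_eq)
  have Q_iff: "(\<forall>n. Q n u w) \<longleftrightarrow> pres_eq ?R u w" for u w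
  proof
    show "\<forall>n. Q n u w" if "pres_eq ?R u w"
      using that unfolding Q_def by (intro allI pres_eq_level_of_graph)
    show "pres_eq ?R u w" if "\<forall>n. Q n u w"
      by (rule graph_relations_separated[OF assms(3,5)]) (use that Q_def in auto)
  qed
  \<comment> \<open>Any representatives will do, since every \<open>Q n\<close> is coarser than
    equality in the group. As a pullback of \<open>level_dist\<close>, \<open>d\<close> is
    nonnegative, symmetric and ultrametric even outside the carrier.\<close>
  define d where "d A B = level_dist Q (SOME u. u \<in> A) (SOME w. w \<in> B)" for A B
  have d: "d (pres_class ?R u) (pres_class ?R w) = level_dist Q u w" for u w
  proof -
    have "(SOME y. y \<in> pres_class ?R x) \<in> pres_class ?R x" for x
      by (rule someI[of _ x]) (simp add: mem_pres_class pres_refl)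
    then have "Q n (SOME y. y \<in> pres_class ?R x) x" for n x
      using Q_iff pres_sym unfolding mem_pres_class by blast
    then show ?thesis
      unfolding d_def by (intro level_dist_cong Q_equiv)
  qed
  have carrier: "carrier ?G = range (pres_class ?R)"
    by (simp add: graph_group_def carrier_presented_group)
  have ultra: "d x z \<le> max (d x y) (d y z)" for x y z
    unfolding d_def using Q_equiv by (rule level_dist_ultra)
  interpret Metric_space "carrier ?G" d
  proof
    show "0 \<le> d x y" for x y
      by (simp add: d_def level_dist_nonneg)
    show "d x y = d y x" for x y
      unfolding d_def using Q_equiv by (rule level_dist_commute)
    show "d x z \<le> d x y + d y z" for x y z
      using ultra[of x z y] level_dist_nonneg[of Q] unfolding d_def by (smt (verit))
    show "d x y = 0 \<longleftrightarrow> x = y" if xy: "x \<in> carrier ?G" "y \<in> carrier ?G" for x y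
    proof -
      obtain u w where "x = pres_class ?R u" "y = pres_class ?R w"
        using xy unfolding carrier by blast
      then show ?thesis
        by (simp only: d level_dist_eq_0_iff Q_iff pres_class_eq_iff)
    qed
  qed
  have "left_invariant_ultrametric ?G d"
    unfolding left_invariant_ultrametric_def ultrametric_on_def
  proof (intro conjI ballI)
    fix g h k assume "g \<in> carrier ?G" "h \<in> carrier ?G" "k \<in> carrier ?G"
    then obtain u v w
      where "g = pres_class ?R u" "h = pres_class ?R v" "k = pres_class ?R w"
      unfolding carrier by blast
    then show "d (g \<otimes>\<^bsub>?G\<^esub> h) (g \<otimes>\<^bsub>?G\<^esub> k) = d h k"
      by (simp add: d graph_group_def mult_presented_group
          level_dist_def Q_def pres_eq_append_cancel)
  qed (rule Metric_space_axioms, rule ultra)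
  moreover have "separable_space mtopology"
  proof -
    define trunc :: "nat \<Rightarrow> (nat \<Rightarrow> nat) \<Rightarrow> nat \<Rightarrow> nat"
      where "trunc n \<eta> i = (if i < n then \<eta> i else 0)" for n \<eta> i
    \<comment> \<open>These are the eventually zero sequences; coding them by finite lists makes
      countability immediate.\<close>
    define V :: "(nat \<Rightarrow> nat) set"
      where "V = range (\<lambda>xs i. if i < length xs then xs ! i else 0)"
    define C where "C = pres_class ?R ` lists (V \<times> UNIV)"
    have "countable C"
      unfolding C_def V_def by (intro countable_image countable_lists countable_SIGMA) simp_all
    moreover have "C \<subseteq> carrier ?G"
      by (auto simp: C_def carrier)
    moreover have "\<exists>y\<in>C. y \<in> mball x r" if x: "x \<in> carrier ?G" and "r > 0" for x r
    proof -
      obtain u where u: "x = pres_class ?R u"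
        using x by (auto simp: carrier)
      obtain n where n: "(1 / 2) ^ n < r"
        using real_arch_pow_inv[OF \<open>r > 0\<close>, of "1 / 2"] by auto
      define w where "w = map (apfst (trunc n)) u"
      have "trunc n \<eta> \<in> V" for \<eta>
        unfolding V_def by (rule image_eqI[of _ _ "map \<eta> [0..<n]"]) (auto simp: trunc_def)
      then have "w \<in> lists (V \<times> UNIV)"
        by (auto simp: w_def)
      then have w: "pres_class ?R w \<in> C" by (simp add: C_def)
      \<comment> \<open>Truncation at \<open>n\<close> keeps the first \<open>k + 1 \<le> n\<close>
        coordinates of every letter.\<close>
      have "Q k u w" if "k < n" for k
        unfolding Q_def w_def using that
        by (intro pres_eq_level_map) (auto simp: agree_def trunc_def)
      then have "level_dist Q u w \<le> (1 / 2) ^ (n + 1)"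
        by (simp only: level_dist_le_iff) blast
      also have "\<dots> \<le> (1 / 2 :: real) ^ n" by simp
      finally have "d x (pres_class ?R w) < r"
        using n by (simp add: u d)
      then show ?thesis
        using w x \<open>C \<subseteq> carrier ?G\<close> by auto
    qed
    ultimately show ?thesis
      unfolding separable_space_def
      by (intro exI[of _ C]) (auto simp: metric_closure_of)
  qed
  moreover have "d (graph_gen E p \<eta>) (graph_gen E p \<nu>) = baire_dist \<eta> \<nu>" for \<eta> \<nu>
    by (simp add: graph_gen_def d baire_dist_eq_level_dist level_dist_def Q_def
        pres_eq_level_gen_iff[OF assms(4,5)])
  ultimately show ?thesis by blast
qed

end
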